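(* Let $p\in(0,1)$ (not necessarily constant, i.e. $p=p(n)$), and let $\sigma=\{=,P\}$ with $P$ binary. Then there are stochastic FO reductions $G(n,p^2)\preceq\vec{G}(n,p)\preceq D^{\sigma}(n,p)$. In particular, for a constant $p\in(0,1)$, $\vec G(n,p)$ obeys the FO 0--1 law.
   Context: $G(n,p)$: random simple undirected loopless graph on $[n]$, each of the $\binom n2$ edges present independently with probability $p$ (signature $\{=,\sim\}$). $\vec G(n,p)$: random directed graph without loops on $[n]$ over signature $\{=,\rightarrow\}$, each of the $n(n-1)$ possible arcs present independently with probability $p$. $D^{\sigma}(n,p)$: the random structure on $[n]$ over $\{=,P\}$ where each of the $n^2$ pairs $(x,y)\in[n]^2$ (including $x=y$) satisfies $P$ independently with probability $p$. Stochastic FO reduction: let $\sigma,\sigma'$ be relational signatures, $\mathcal{D}$ and $\mathcal{D}'$ the sets of all finite structures with domains $[n]$, $n\in\mathbb N$, over $\sigma,\sigma'$, and $\mathcal A,\mathcal A'$ the algebras of their subsets of the form $\{X: X\models\varphi\}$ for FO sentences $\varphi$. For sequences $D=(D_n)$, $D'=(D'_n)$ of random structures with domain $[n]$ over $\sigma,\sigma'$, a stochastic FO reduction from $D'$ to $D$ is a map $f:\mathcal D\to\mathcal D'$ sending structures on $[n]$ to structures on $[n]$, such that for every FO sentence $\varphi'$ over $\sigma'$ the set $f^{-1}(\{X:X\models\varphi'\})$ equals $\{X:X\models\varphi\}$ for some FO sentence $\varphi=:f^{-1}(\varphi')$ over $\sigma$, and $\lim_{n\to\infty}|\Pr(D_n\models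 f^{-1}(\varphi'))-\Pr(D'_n\models\varphi')|=0$. We write $D'\preceq D$ if such a reduction exists. A sequence $(D_n)$ obeys the FO 0--1 law if for every FO sentence $\varphi$, $\Pr(D_n\models\varphi)$ converges to $0$ or to $1$. *)

theory Defs
  imports "HOL-Probability.Probability"
begin

subsection \<open>First-order logic over relational signatures\<close>

text \<open>A signature maps each of its relation symbols to its arity; equality is a logical symbol.\<close>

type_synonym 'r signature = "'r \<rightharpoonup> nat"

datatype 'r fm =
    Eq nat nat
  | Rel 'r "nat list"
  | Neg "'r fm"
  | Conj "'r fm" "'r fm"
  | Ex nat "'r fm"

fun wf_fm :: "'r signature \<Rightarrow> 'r fm \<Rightarrow> bool" where
  "wf_fm \<sigma> (Eq x y) \<longleftrightarrow> True"
| "wf_fm \<sigma> (Rel R xs) \<longleftrightarrow> \<sigma> R = Some (length xs)"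
| "wf_fm \<sigma> (Neg \<phi>) \<longleftrightarrow> wf_fm \<sigma> \<phi>"
| "wf_fm \<sigma> (Conj \<phi> \<psi>) \<longleftrightarrow> wf_fm \<sigma> \<phi> \<and> wf_fm \<sigma> \<psi>"
| "wf_fm \<sigma> (Ex x \<phi>) \<longleftrightarrow> wf_fm \<sigma> \<phi>"

fun free_vars :: "'r fm \<Rightarrow> nat set" where
  "free_vars (Eq x y) = {x, y}"
| "free_vars (Rel R xs) = set xs"
| "free_vars (Neg \<phi>) = free_vars \<phi>"
| "free_vars (Conj \<phi> \<psi>) = free_vars \<phi> \<union> free_vars \<psi>"
| "free_vars (Ex x \<phi>) = free_vars \<phi> - {x}"

definition sentence :: "'r signature \<Rightarrow> 'r fm \<Rightarrow> bool" where
  "sentence \<sigma> \<phi> \<longleftrightarrow> wf_fm \<sigma> \<phi> \<and> free_vars \<phi> = {}"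

text \<open>A structure with domain \<open>[n] = {1..n}\<close> is given by \<open>n\<close> and the interpretation of the symbols.\<close>

record 'r fstruct =
  dom_size :: nat
  interp :: "'r \<Rightarrow> nat list set"

abbreviation universe :: "'r fstruct \<Rightarrow> nat set" where
  "universe M \<equiv> {1..dom_size M}"

definition structures_on :: "'r signature \<Rightarrow> nat \<Rightarrow> 'r fstruct set" where
  "structures_on \<sigma> n = {M. dom_size M = n \<and>
     (\<forall>R. interp M R \<subseteq> {xs. \<sigma> R = Some (length xs) \<and> set xs \<subseteq> {1..n}})}"

text \<open>As usual in first-order logic, domains are nonempty.\<close>

definition structures :: "'r signature \<Rightarrow> 'r fstruct set" where
  "structures \<sigma> = (\<Union>n\<in>{1..}. structures_on \<sigma> n)"

fun sat :: "'r fstruct \<Rightarrow> (nat \<Rightarrow> nat) \<Rightarrow> 'r fm \<Rightarrow> bool" where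
  "sat M e (Eq x y) \<longleftrightarrow> e x = e y"
| "sat M e (Rel R xs) \<longleftrightarrow> map e xs \<in> interp M R"
| "sat M e (Neg \<phi>) \<longleftrightarrow> \<not> sat M e \<phi>"
| "sat M e (Conj \<phi> \<psi>) \<longleftrightarrow> sat M e \<phi> \<and> sat M e \<psi>"
| "sat M e (Ex x \<phi>) \<longleftrightarrow> (\<exists>a\<in>universe M. sat M (e(x := a)) \<phi>)"

definition models :: "'r fstruct \<Rightarrow> 'r fm \<Rightarrow> bool" (infix "\<Turnstile>" 50) where
  "M \<Turnstile> \<phi> \<longleftrightarrow> (\<forall>e. range e \<subseteq> universe M \<longrightarrow> sat M e \<phi>)"

definition Mod :: "'r signature \<Rightarrow> 'r fm \<Rightarrow> 'r fstruct set" where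
  "Mod \<sigma> \<phi> = {M \<in> structures \<sigma>. M \<Turnstile> \<phi>}"

subsection \<open>Random structures and stochastic reductions\<close>

text \<open>Sequences of random structures are indexed by the domain size \<open>n \<ge> 1\<close>; the value at
  \<open>0\<close> is irrelevant.\<close>

definition random_structures :: "'r signature \<Rightarrow> (nat \<Rightarrow> 'r fstruct pmf) \<Rightarrow> bool" where
  "random_structures \<sigma> D \<longleftrightarrow> (\<forall>n\<ge>1. set_pmf (D n) \<subseteq> structures_on \<sigma> n)"

definition prob_models :: "'r fstruct pmf \<Rightarrow> 'r fm \<Rightarrow> real" where
  "prob_models D \<phi> = measure_pmf.prob D {M. M \<Turnstile> \<phi>}"

definition stochastic_FO_reduction ::
  "'s signature \<Rightarrow> (nat \<Rightarrow> 's fstruct pmf) \<Rightarrow> 'r signature \<Rightarrow> (nat \<Rightarrow> 'r fstruct pmf) \<Rightarrow>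
   ('r fstruct \<Rightarrow> 's fstruct) \<Rightarrow> bool" where
  "stochastic_FO_reduction \<sigma>' D' \<sigma> D f \<longleftrightarrow>
     random_structures \<sigma>' D' \<and> random_structures \<sigma> D \<and>
     (\<forall>n\<ge>1. f ` structures_on \<sigma> n \<subseteq> structures_on \<sigma>' n) \<and>
     (\<forall>\<phi>'. sentence \<sigma>' \<phi>' \<longrightarrow>
        (\<exists>\<phi>. sentence \<sigma> \<phi> \<and> f -` Mod \<sigma>' \<phi>' \<inter> structures \<sigma> = Mod \<sigma> \<phi> \<and>
             (\<lambda>n. \<bar>prob_models (D n) \<phi> - prob_models (D' n) \<phi>'\<bar>) \<longlonglongrightarrow> 0))"

text \<open>\<open>FO_reducible \<sigma>' D' \<sigma> D\<close> is the relation \<open>D' \<preceq> D\<close>.\<close>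

definition FO_reducible ::
  "'s signature \<Rightarrow> (nat \<Rightarrow> 's fstruct pmf) \<Rightarrow> 'r signature \<Rightarrow> (nat \<Rightarrow> 'r fstruct pmf) \<Rightarrow> bool" where
  "FO_reducible \<sigma>' D' \<sigma> D \<longleftrightarrow> (\<exists>f. stochastic_FO_reduction \<sigma>' D' \<sigma> D f)"

definition FO_zero_one_law :: "'r signature \<Rightarrow> (nat \<Rightarrow> 'r fstruct pmf) \<Rightarrow> bool" where
  "FO_zero_one_law \<sigma> D \<longleftrightarrow> random_structures \<sigma> D \<and>
     (\<forall>\<phi>. sentence \<sigma> \<phi> \<longrightarrow>
        (\<lambda>n. prob_models (D n) \<phi>) \<longlonglongrightarrow> 0 \<or> (\<lambda>n. prob_models (D n) \<phi>) \<longlonglongrightarrow> 1)"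

subsection \<open>The three random models\<close>

datatype sym = Adj | Arc | PSym

definition binary_sig :: "'r \<Rightarrow> 'r signature" where
  "binary_sig R = [R \<mapsto> 2]"

definition binary_struct :: "'r \<Rightarrow> nat \<Rightarrow> (nat \<times> nat) set \<Rightarrow> 'r fstruct" where
  "binary_struct R n E =
     \<lparr>dom_size = n, interp = (\<lambda>S. if S = R then {[x, y] |x y. (x, y) \<in> E} else {})\<rparr>"

text \<open>The random subset of \<open>A\<close> (finite) that contains each element independently with
  probability \<open>p\<close>.\<close>

definition random_subset :: "'a set \<Rightarrow> real \<Rightarrow> 'a set pmf" where
  "random_subset A p = map_pmf (\<lambda>b. {x \<in> A. b x}) (Pi_pmf A False (\<lambda>_. bernoulli_pmf p))"

definition rand_graph :: "nat \<Rightarrow> real \<Rightarrow> sym fstruct pmf" where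
  "rand_graph n p =
     map_pmf (\<lambda>E. binary_struct Adj n {(x, y). {x, y} \<in> E})
       (random_subset {e. e \<subseteq> {1..n} \<and> card e = 2} p)"

definition rand_digraph :: "nat \<Rightarrow> real \<Rightarrow> sym fstruct pmf" where
  "rand_digraph n p =
     map_pmf (binary_struct Arc n)
       (random_subset {(x, y). x \<in> {1..n} \<and> y \<in> {1..n} \<and> x \<noteq> y} p)"

definition rand_binary :: "nat \<Rightarrow> real \<Rightarrow> sym fstruct pmf" where
  "rand_binary n p = map_pmf (binary_struct PSym n) (random_subset ({1..n} \<times> {1..n}) p)"

end

theory Submission
  imports Defs "HOL-Real_Asymp.Real_Asymp"
begin

text \<open>
  Both reductions are quantifier-free interpretations that transport the laws exactly. Dropping the
  loops of a random binary relation leaves a random digraph; the pairs of vertices joined in both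
  directions form \<open>G(n, p\<^sup>2)\<close>, because different pairs read disjoint blocks of arcs.

  For the zero-one law, let \<open>k\<close> be the number of variables of a sentence \<open>\<phi>\<close>. Two loopless digraphs in
  which every adjacency pattern over at most \<open>k\<close> vertices is realised by a further vertex agree on \<open>\<phi>\<close>,
  by a back-and-forth argument in which the variables are the pebbles. With \<open>q = min p (1 - p)\<close>, a
  random digraph lacks this property with probability at most
  \<open>(n + 1)\<^bsup>3k\<^esup> (1 - q\<^bsup>2k\<^esup>)\<^bsup>n - k\<^esup>\<close>, by a union bound over the patterns, and this tends to \<open>0\<close>.
\<close>

section \<open>First-order interpretations\<close>

text \<open>\<open>\<delta>\<close> receives the actual argument list of the atom, so no
  substitution of variables is needed. Quantifiers are not relativised: source and target share
  their domain.\<close>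

fun interpret_fm :: "('s \<Rightarrow> nat list \<Rightarrow> 'r fm) \<Rightarrow> 's fm \<Rightarrow> 'r fm" where
  "interpret_fm \<delta> (Eq x y) = Eq x y"
| "interpret_fm \<delta> (Rel R xs) = \<delta> R xs"
| "interpret_fm \<delta> (Neg \<phi>) = Neg (interpret_fm \<delta> \<phi>)"
| "interpret_fm \<delta> (Conj \<phi> \<psi>) = Conj (interpret_fm \<delta> \<phi>) (interpret_fm \<delta> \<psi>)"
| "interpret_fm \<delta> (Ex x \<phi>) = Ex x (interpret_fm \<delta> \<phi>)"

lemma wf_interpret_fm:
  assumes "\<And>R xs. \<sigma>' R = Some (length xs) \<Longrightarrow> wf_fm \<sigma> (\<delta> R xs)" and "wf_fm \<sigma>' \<phi>"
  shows "wf_fm \<sigma> (interpret_fm \<delta> \<phi>)"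
  using assms(2) by (induction \<phi>) (auto intro: assms(1))

lemma free_vars_interpret_fm:
  assumes "\<And>R xs. \<sigma>' R = Some (length xs) \<Longrightarrow> free_vars (\<delta> R xs) \<subseteq> set xs" and "wf_fm \<sigma>' \<phi>"
  shows "free_vars (interpret_fm \<delta> \<phi>) \<subseteq> free_vars \<phi>"
  using assms(2)
proof (induction \<phi>)
  case (Rel R xs)
  then show ?case using assms(1)[of R xs] by simp
qed auto

lemma sat_interpret_fm:
  assumes "dom_size N = dom_size M"
    and "\<And>R xs e. \<sigma>' R = Some (length xs) \<Longrightarrow> sat M e (\<delta> R xs) \<longleftrightarrow> map e xs \<in> interp N R"
    and "wf_fm \<sigma>' \<phi>"
  shows "sat M e (interpret_fm \<delta> \<phi>) \<longleftrightarrow> sat N e \<phi>"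
  using assms(3) by (induction \<phi> arbitrary: e) (auto simp: assms(1,2))

text \<open>The translated sentence holds in \<open>M\<close> exactly when the original holds in
  \<open>f M\<close>. As \<open>D' n\<close> is the image of \<open>D n\<close> under
  \<open>f\<close>, the two probabilities coincide for every \<open>n \<ge> 1\<close>, which is more
  than the limit asks for.\<close>

lemma FO_reducible_interpretation:
  assumes D': "random_structures \<sigma>' D'" and D: "random_structures \<sigma> D"
    and f: "\<And>n M. n \<ge> 1 \<Longrightarrow> M \<in> structures_on \<sigma> n \<Longrightarrow> f M \<in> structures_on \<sigma>' n"
    and wf: "\<And>R xs. \<sigma>' R = Some (length xs) \<Longrightarrow> wf_fm \<sigma> (\<delta> R xs)"
    and fv: "\<And>R xs. \<sigma>' R = Some (length xs) \<Longrightarrow> free_vars (\<delta> R xs) \<subseteq> set xs"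
    and sat: "\<And>M R xs e. \<sigma>' R = Some (length xs) \<Longrightarrow>
                sat M e (\<delta> R xs) \<longleftrightarrow> map e xs \<in> interp (f M) R"
    and dist: "\<And>n. n \<ge> 1 \<Longrightarrow> D' n = map_pmf f (D n)"
    and dom: "\<And>M. dom_size (f M) = dom_size M"
  shows "FO_reducible \<sigma>' D' \<sigma> D"
proof -
  have "\<exists>\<phi>. sentence \<sigma> \<phi> \<and> f -` Mod \<sigma>' \<phi>' \<inter> structures \<sigma> = Mod \<sigma> \<phi> \<and>
             (\<lambda>n. \<bar>prob_models (D n) \<phi> - prob_models (D' n) \<phi>'\<bar>) \<longlonglongrightarrow> 0"
    if \<phi>': "sentence \<sigma>' \<phi>'" for \<phi>'
  proof (intro exI conjI)
    let ?\<phi> = "interpret_fm \<delta> \<phi>'"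
    have w: "wf_fm \<sigma>' \<phi>'" and "free_vars \<phi>' = {}"
      using \<phi>' by (auto simp: sentence_def)
    then show "sentence \<sigma> ?\<phi>"
      using wf_interpret_fm[OF wf w] free_vars_interpret_fm[OF fv w]
      by (auto simp: sentence_def)
    have models: "M \<Turnstile> ?\<phi> \<longleftrightarrow> f M \<Turnstile> \<phi>'" for M
      using sat_interpret_fm[OF dom sat w] by (simp add: models_def dom)
    have "f M \<in> structures \<sigma>'" if "M \<in> structures \<sigma>" for M
      using that f by (auto simp: structures_def)
    then show "f -` Mod \<sigma>' \<phi>' \<inter> structures \<sigma> = Mod \<sigma> ?\<phi>"
      by (auto simp: Mod_def models)
    have "prob_models (D n) ?\<phi> = prob_models (D' n) \<phi>'" if "n \<ge> 1" for n
      by (simp add: prob_models_def dist[OF that] measure_map_pmf vimage_def models)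
    then have "eventually (\<lambda>n. \<bar>prob_models (D n) ?\<phi> - prob_models (D' n) \<phi>'\<bar> = 0) sequentially"
      by (intro eventually_sequentiallyI[of 1]) simp
    then show "(\<lambda>n. \<bar>prob_models (D n) ?\<phi> - prob_models (D' n) \<phi>'\<bar>) \<longlonglongrightarrow> 0"
      by (rule tendsto_eventually)
  qed
  then have "stochastic_FO_reduction \<sigma>' D' \<sigma> D f"
    using D' D f by (auto simp: stochastic_FO_reduction_def)
  then show ?thesis
    by (auto simp: FO_reducible_def)
qed

section \<open>Random subsets\<close>

text \<open>Functions of disjoint blocks of independent coordinates are independent.\<close>

lemma Pi_pmf_blocks:
  assumes "finite I" "finite A" "\<And>i. i \<in> I \<Longrightarrow> K i \<subseteq> A" "disjoint_family_on K I"
    and g: "\<And>i b b'. i \<in> I \<Longrightarrow> (\<And>x. x \<in> K i \<Longrightarrow> b x = b' x) \<Longrightarrow> g i b = g i b'"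
  shows "map_pmf (\<lambda>b i. if i \<in> I then g i b else d') (Pi_pmf A d q) =
         Pi_pmf I d' (\<lambda>i. map_pmf (g i) (Pi_pmf (K i) d q))"
  using assms
proof (induction I arbitrary: A rule: finite_induct)
  case empty
  then show ?case by simp
next
  case (insert i J)
  \<comment> \<open>The induction leaves \<open>A\<close> arbitrary, so its hypothesis applies to
    the coordinates that remain once the block of \<open>i\<close> is removed.\<close>
  let ?B = "A - K i"
  let ?G = "\<lambda>b j. if j \<in> J then g j b else d'"
  have disj: "K j \<inter> K i = {}" if "j \<in> J" for j
    using insert.prems(3) insert.hyps(2) that by (auto simp: disjoint_family_on_def)
  have sub: "K j \<subseteq> ?B" if "j \<in> J" for j
    using disj[OF that] insert.prems(2) that by auto
  have IH: "map_pmf ?G (Pi_pmf ?B d q) = Pi_pmf J d' (\<lambda>j. map_pmf (g j) (Pi_pmf (K j) d q))"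
  proof (rule insert.IH)
    show "disjoint_family_on K J"
      using insert.prems(3) by (auto simp: disjoint_family_on_def)
    show "g j b = g j b'" if "j \<in> J" "\<And>x. x \<in> K j \<Longrightarrow> b x = b' x" for j b b'
      using insert.prems(4)[of j b b'] that by auto
  qed (use insert.prems sub in auto)
  have fin: "finite (K i)"
    using insert.prems by (auto intro: finite_subset)
  have A: "A = K i \<union> ?B"
    using insert.prems(2) by auto
  \<comment> \<open>Since each \<open>g j\<close> reads only \<open>K j\<close>, gluing
    \<open>u\<close> on \<open>K i\<close> to \<open>v\<close> elsewhere separates completely:
    \<open>u\<close> determines the value at \<open>i\<close>, and \<open>v\<close> all the
    others.\<close>
  have eq: "(\<lambda>j. if j \<in> insert i J then g j (\<lambda>x. if x \<in> K i then u x else v x) else d')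
      = (?G v)(i := g i u)" for u v
  proof
    fix j
    have "g i (\<lambda>x. if x \<in> K i then u x else v x) = g i u"
      by (rule insert.prems(4)) auto
    moreover have "g j (\<lambda>x. if x \<in> K i then u x else v x) = g j v" if "j \<in> J"
      using disj[OF that] that by (intro insert.prems(4)) auto
    ultimately show "(if j \<in> insert i J then g j (\<lambda>x. if x \<in> K i then u x else v x) else d')
      = ((?G v)(i := g i u)) j"
      by auto
  qed
  have "map_pmf (\<lambda>b j. if j \<in> insert i J then g j b else d') (Pi_pmf A d q) =
        map_pmf (\<lambda>(u, v). (?G v)(i := g i u)) (pair_pmf (Pi_pmf (K i) d q) (Pi_pmf ?B d q))"
    by (subst A, subst Pi_pmf_union) (use fin insert.prems(1) in
        \<open>auto simp: map_pmf_comp case_prod_unfold eq simp del: insert_iff\<close>)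
  also have "\<dots> = map_pmf (\<lambda>(y, h). h(i := y))
      (map_pmf (\<lambda>(u, v). (g i u, ?G v)) (pair_pmf (Pi_pmf (K i) d q) (Pi_pmf ?B d q)))"
    by (simp add: map_pmf_comp case_prod_unfold)
  also have "\<dots> = map_pmf (\<lambda>(y, h). h(i := y))
      (pair_pmf (map_pmf (g i) (Pi_pmf (K i) d q)) (map_pmf ?G (Pi_pmf ?B d q)))"
    by (simp only: map_pair)
  also have "\<dots> = Pi_pmf (insert i J) d' (\<lambda>j. map_pmf (g j) (Pi_pmf (K j) d q))"
    by (simp only: IH Pi_pmf_insert[OF insert.hyps])
  finally show ?case .
qed

lemma set_pmf_random_subset: "set_pmf (random_subset A p) \<subseteq> Pow A"
  by (auto simp: random_subset_def)

text \<open>This identifies the law of an event's indicator from the probability of the event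
  alone.\<close>

lemma pmf_bool_eq_bernoulli: "P = bernoulli_pmf (pmf P True)"
proof (rule pmf_eqI)
  fix b :: bool
  have "pmf P True + pmf P False = 1"
    using sum_pmf_eq_1[of UNIV P, OF finite subset_UNIV] by (simp add: UNIV_bool add.commute)
  then show "pmf P b = pmf (bernoulli_pmf (pmf P True)) b"
    by (cases b) (auto simp: pmf_le_1)
qed

text \<open>The event is a product event over independent coordinates. The default \<open>d\<close>
  is never read, because only coordinates in \<open>K\<close> are tested.\<close>

lemma all_bernoulli:
  assumes "finite K" "0 \<le> p" "p \<le> 1"
  shows "map_pmf (\<lambda>b. \<forall>x\<in>K. b x) (Pi_pmf K d (\<lambda>_. bernoulli_pmf p)) = bernoulli_pmf (p ^ card K)"
proof -
  have "pmf (map_pmf (\<lambda>b. \<forall>x\<in>K. b x) (Pi_pmf K d (\<lambda>_. bernoulli_pmf p))) True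
      = measure_pmf.prob (Pi_pmf K d (\<lambda>_. bernoulli_pmf p)) (Pi K (\<lambda>_. {True}))"
    by (simp add: pmf_map vimage_def Pi_def Ball_def)
  also have "\<dots> = p ^ card K"
    using assms by (simp add: measure_Pi_pmf_Pi measure_pmf_single)
  finally show ?thesis
    by (metis pmf_bool_eq_bernoulli)
qed

text \<open>Disjoint blocks make the events \<open>K i \<subseteq> E\<close> independent, and equal
  block sizes give them the common probability \<open>p ^ m\<close>. Blocks of two arcs yield the
  random graph, singleton blocks the restriction to a subset.\<close>

lemma map_random_subset_blocks:
  assumes "finite I" "finite A" "\<And>i. i \<in> I \<Longrightarrow> K i \<subseteq> A" "disjoint_family_on K I"
    and m: "\<And>i. i \<in> I \<Longrightarrow> card (K i) = m" and p: "0 \<le> p" "p \<le> 1"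
  shows "map_pmf (\<lambda>E. {i \<in> I. K i \<subseteq> E}) (random_subset A p) = random_subset I (p ^ m)"
proof -
  have fin: "finite (K i)" if "i \<in> I" for i
    using assms that by (auto intro: finite_subset)
  have "map_pmf (\<lambda>E. {i \<in> I. K i \<subseteq> E}) (random_subset A p) =
        map_pmf (\<lambda>b. {i \<in> I. b i}) (map_pmf (\<lambda>b i. if i \<in> I then \<forall>x\<in>K i. b x else False)
          (Pi_pmf A False (\<lambda>_. bernoulli_pmf p)))"
    unfolding random_subset_def map_pmf_comp
    by (rule map_pmf_cong) (use assms(3) in auto)
  also have "\<dots> = map_pmf (\<lambda>b. {i \<in> I. b i}) (Pi_pmf I False (\<lambda>i.
      map_pmf (\<lambda>b. \<forall>x\<in>K i. b x) (Pi_pmf (K i) False (\<lambda>_. bernoulli_pmf p))))"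
    by (subst Pi_pmf_blocks) (use assms in auto)
  also have "\<dots> = map_pmf (\<lambda>b. {i \<in> I. b i}) (Pi_pmf I False (\<lambda>i. bernoulli_pmf (p ^ m)))"
    by (intro arg_cong2[where f = map_pmf] Pi_pmf_cong refl) (simp add: all_bernoulli fin p m)
  finally show ?thesis
    by (simp add: random_subset_def)
qed

lemma map_random_subset_Int:
  assumes "finite A" "B \<subseteq> A" "0 \<le> p" "p \<le> 1"
  shows "map_pmf (\<lambda>E. E \<inter> B) (random_subset A p) = random_subset B p"
proof -
  have "map_pmf (\<lambda>E. {i \<in> B. {i} \<subseteq> E}) (random_subset A p) = random_subset B (p ^ 1)"
    using assms by (intro map_random_subset_blocks) (auto simp: disjoint_family_on_def intro: finite_subset)
  moreover have "(\<lambda>E. {i \<in> B. {i} \<subseteq> E}) = (\<lambda>E. E \<inter> B)"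
    by auto
  ultimately show ?thesis by simp
qed

section \<open>The two reductions\<close>

abbreviation arcs :: "nat \<Rightarrow> (nat \<times> nat) set" where
  "arcs n \<equiv> {(x, y). x \<in> {1..n} \<and> y \<in> {1..n} \<and> x \<noteq> y}"

lemma finite_arcs: "finite (arcs n)"
  by (rule finite_subset[of _ "{1..n} \<times> {1..n}"]) auto

lemma binary_struct_in_structures_on:
  "E \<subseteq> {1..n} \<times> {1..n} \<Longrightarrow> binary_struct R n E \<in> structures_on (binary_sig R) n"
  by (auto simp: binary_struct_def structures_on_def binary_sig_def)

text \<open>One argument serves all three models: \<open>g n\<close> is the identity for the two
  directed ones, and turns a set of edges into a symmetric relation for graphs.\<close>

lemma random_structures_binary_struct:
  assumes "\<And>n E. E \<subseteq> A n \<Longrightarrow> g n E \<subseteq> {1..n} \<times> {1..n}"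
  shows "random_structures (binary_sig R)
           (\<lambda>n. map_pmf (\<lambda>E. binary_struct R n (g n E)) (random_subset (A n) (p n)))"
  unfolding random_structures_def
proof (intro allI impI subsetI)
  fix n M
  assume "M \<in> set_pmf (map_pmf (\<lambda>E. binary_struct R n (g n E)) (random_subset (A n) (p n)))"
  then obtain E where E: "E \<in> set_pmf (random_subset (A n) (p n))" "M = binary_struct R n (g n E)"
    by auto
  then have "E \<subseteq> A n" using set_pmf_random_subset by blast
  then show "M \<in> structures_on (binary_sig R) n"
    unfolding E(2) by (intro binary_struct_in_structures_on assms)
qed

lemma random_structures_digraph: "random_structures (binary_sig Arc) (\<lambda>n. rand_digraph n (p n))"
  unfolding rand_digraph_def by (rule random_structures_binary_struct) auto

lemma random_structures_binary: "random_structures (binary_sig PSym) (\<lambda>n. rand_binary n (p n))"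
  unfolding rand_binary_def by (rule random_structures_binary_struct)

lemma random_structures_graph: "random_structures (binary_sig Adj) (\<lambda>n. rand_graph n (p n))"
  unfolding rand_graph_def by (rule random_structures_binary_struct) auto

section \<open>The two maps between structures and their effect on the laws\<close>

definition digraph_to_graph :: "sym fstruct \<Rightarrow> sym fstruct" where
  "digraph_to_graph M = binary_struct Adj (dom_size M)
     {(x, y). x \<noteq> y \<and> [x, y] \<in> interp M Arc \<and> [y, x] \<in> interp M Arc}"

definition binary_to_digraph :: "sym fstruct \<Rightarrow> sym fstruct" where
  "binary_to_digraph M = binary_struct Arc (dom_size M)
     {(x, y). x \<noteq> y \<and> [x, y] \<in> interp M PSym}"

lemma rand_graph_eq_map_digraph:
  assumes "0 \<le> p" "p \<le> 1"
  shows "rand_graph n (p\<^sup>2) = map_pmf digraph_to_graph (rand_digraph n p)"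
proof -
  let ?I = "{e. e \<subseteq> {1..n} \<and> card e = 2}"
  \<comment> \<open>The block of a potential edge consists of the two opposite arcs on its
    endpoints; both are present with probability \<open>p\<^sup>2\<close>.\<close>
  define K :: "nat set \<Rightarrow> (nat \<times> nat) set" where "K e = {(x, y). x \<noteq> y \<and> {x, y} = e}" for e
  have cardK: "card (K e) = 2" if "e \<in> ?I" for e
  proof -
    have "card e = 2" using that by simp
    then obtain x y where xy: "e = {x, y}" "x \<noteq> y"
      unfolding card_2_iff by blast
    then have "K e = {(x, y), (y, x)}"
      by (auto simp: K_def doubleton_eq_iff)
    then show ?thesis
      using xy by simp
  qed
  have "random_subset ?I (p\<^sup>2) = map_pmf (\<lambda>E. {e \<in> ?I. K e \<subseteq> E}) (random_subset (arcs n) p)"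
    by (rule map_random_subset_blocks[symmetric])
      (use assms cardK finite_arcs in \<open>auto simp: K_def disjoint_family_on_def\<close>)
  then have "rand_graph n (p\<^sup>2) = map_pmf (\<lambda>E. binary_struct Adj n {(x, y). {x, y} \<in> {e \<in> ?I. K e \<subseteq> E}})
      (random_subset (arcs n) p)"
    by (simp add: rand_graph_def map_pmf_comp)
  also have "\<dots> = map_pmf (\<lambda>E. digraph_to_graph (binary_struct Arc n E)) (random_subset (arcs n) p)"
  proof (rule map_pmf_cong[OF refl])
    fix E assume "E \<in> set_pmf (random_subset (arcs n) p)"
    then have E: "E \<subseteq> arcs n"
      using set_pmf_random_subset by blast
    \<comment> \<open>From right to left, \<open>E \<subseteq> arcs n\<close> is what places both
      endpoints in \<open>{1..n}\<close>.\<close>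
    have "{x, y} \<in> ?I \<and> K {x, y} \<subseteq> E \<longleftrightarrow> x \<noteq> y \<and> (x, y) \<in> E \<and> (y, x) \<in> E" for x y
      using E by (auto simp: K_def doubleton_eq_iff card_2_iff)
    then show "binary_struct Adj n {(x, y). {x, y} \<in> {e \<in> ?I. K e \<subseteq> E}}
        = digraph_to_graph (binary_struct Arc n E)"
      by (simp add: digraph_to_graph_def binary_struct_def)
  qed
  finally show ?thesis
    by (simp add: rand_digraph_def map_pmf_comp)
qed

lemma rand_digraph_eq_map_binary:
  assumes "0 \<le> p" "p \<le> 1"
  shows "rand_digraph n p = map_pmf binary_to_digraph (rand_binary n p)"
proof -
  have "random_subset (arcs n) p = map_pmf (\<lambda>E. E \<inter> arcs n) (random_subset ({1..n} \<times> {1..n}) p)"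
    by (rule map_random_subset_Int[symmetric]) (use assms in auto)
  then have "rand_digraph n p = map_pmf (\<lambda>E. binary_struct Arc n (E \<inter> arcs n))
      (random_subset ({1..n} \<times> {1..n}) p)"
    by (simp add: rand_digraph_def map_pmf_comp)
  also have "\<dots> = map_pmf (\<lambda>E. binary_to_digraph (binary_struct PSym n E))
      (random_subset ({1..n} \<times> {1..n}) p)"
  proof (rule map_pmf_cong[OF refl])
    fix E assume "E \<in> set_pmf (random_subset ({1..n} \<times> {1..n}) p)"
    then have "E \<subseteq> {1..n} \<times> {1..n}"
      using set_pmf_random_subset by blast
    then have "E \<inter> arcs n = {(x, y). x \<noteq> y \<and> (x, y) \<in> E}"
      by auto
    then show "binary_struct Arc n (E \<inter> arcs n) = binary_to_digraph (binary_struct PSym n E)"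
      by (simp add: binary_to_digraph_def binary_struct_def)
  qed
  finally show ?thesis
    by (simp add: rand_binary_def map_pmf_comp)
qed

lemma binary_sig_eq_Some_length:
  assumes "binary_sig R S = Some (length xs)"
  obtains x y where "S = R" "xs = [x, y]"
  using assms
  by (cases xs; cases "tl xs"; cases "tl (tl xs)") (auto simp: binary_sig_def split: if_splits)

lemma FO_reducible_graph_digraph:
  assumes "\<And>n. n \<ge> 1 \<Longrightarrow> 0 \<le> p n \<and> p n \<le> 1"
  shows "FO_reducible (binary_sig Adj) (\<lambda>n. rand_graph n ((p n)\<^sup>2))
                      (binary_sig Arc) (\<lambda>n. rand_digraph n (p n))"
proof (rule FO_reducible_interpretation[OF random_structures_graph random_structures_digraph])
  \<comment> \<open>The formula is written for arbitrary lists; the arity of \<open>Adj\<close>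
    leaves only lists of length two to consider.\<close>
  let ?\<delta> = "\<lambda>(_ :: sym) xs. Conj (Neg (Eq (xs ! 0) (xs ! 1)))
              (Conj (Rel Arc [xs ! 0, xs ! 1]) (Rel Arc [xs ! 1, xs ! 0]))"
  show "digraph_to_graph M \<in> structures_on (binary_sig Adj) n"
    if "M \<in> structures_on (binary_sig Arc) n" for n M
  proof -
    have "dom_size M = n" "interp M Arc \<subseteq> {xs. set xs \<subseteq> {1..n}}"
      using that by (auto simp: structures_on_def)
    then show ?thesis
      unfolding digraph_to_graph_def by (auto intro!: binary_struct_in_structures_on)
  qed
  show "rand_graph n ((p n)\<^sup>2) = map_pmf digraph_to_graph (rand_digraph n (p n))" if "n \<ge> 1" for n
    using assms[OF that] by (intro rand_graph_eq_map_digraph) auto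
  fix R :: sym and xs :: "nat list"
  assume "binary_sig Adj R = Some (length xs)"
  then obtain x y where *: "R = Adj" "xs = [x, y]"
    by (rule binary_sig_eq_Some_length)
  show "wf_fm (binary_sig Arc) (?\<delta> R xs)"
    by (simp add: binary_sig_def)
  show "free_vars (?\<delta> R xs) \<subseteq> set xs"
    by (simp add: *)
  show "sat M e (?\<delta> R xs) \<longleftrightarrow> map e xs \<in> interp (digraph_to_graph M) R" for M e
    by (simp add: * digraph_to_graph_def binary_struct_def)
qed (simp add: digraph_to_graph_def binary_struct_def)

lemma FO_reducible_digraph_binary:
  assumes "\<And>n. n \<ge> 1 \<Longrightarrow> 0 \<le> p n \<and> p n \<le> 1"
  shows "FO_reducible (binary_sig Arc) (\<lambda>n. rand_digraph n (p n))
                      (binary_sig PSym) (\<lambda>n. rand_binary n (p n))"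
proof (rule FO_reducible_interpretation[OF random_structures_digraph random_structures_binary])
  let ?\<delta> = "\<lambda>(_ :: sym) xs. Conj (Neg (Eq (xs ! 0) (xs ! 1))) (Rel PSym [xs ! 0, xs ! 1])"
  show "binary_to_digraph M \<in> structures_on (binary_sig Arc) n"
    if "M \<in> structures_on (binary_sig PSym) n" for n M
  proof -
    have "dom_size M = n" "interp M PSym \<subseteq> {xs. set xs \<subseteq> {1..n}}"
      using that by (auto simp: structures_on_def)
    then show ?thesis
      unfolding binary_to_digraph_def by (auto intro!: binary_struct_in_structures_on)
  qed
  show "rand_digraph n (p n) = map_pmf binary_to_digraph (rand_binary n (p n))" if "n \<ge> 1" for n
    using assms[OF that] by (intro rand_digraph_eq_map_binary) auto
  fix R :: sym and xs :: "nat list"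
  assume "binary_sig Arc R = Some (length xs)"
  then obtain x y where *: "R = Arc" "xs = [x, y]"
    by (rule binary_sig_eq_Some_length)
  show "wf_fm (binary_sig PSym) (?\<delta> R xs)"
    by (simp add: binary_sig_def)
  show "free_vars (?\<delta> R xs) \<subseteq> set xs"
    by (simp add: *)
  show "sat M e (?\<delta> R xs) \<longleftrightarrow> map e xs \<in> interp (binary_to_digraph M) R" for M e
    by (simp add: * binary_to_digraph_def binary_struct_def)
qed (simp add: binary_to_digraph_def binary_struct_def)

section \<open>Extension properties\<close>

text \<open>These are the extension axioms for digraphs: \<open>X\<close> prescribes the arcs
  leaving \<open>z\<close>, \<open>Y\<close> those entering it. All sizes up to \<open>k\<close> are
  included because pebbles may share a vertex. Loops at \<open>z\<close> are left open.\<close>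

definition extension_property :: "nat \<Rightarrow> nat \<Rightarrow> (nat \<times> nat) set \<Rightarrow> bool" where
  "extension_property k n E \<longleftrightarrow>
     (\<forall>S X Y. S \<subseteq> {1..n} \<and> card S \<le> k \<and> X \<subseteq> S \<and> Y \<subseteq> S \<longrightarrow>
        (\<exists>z\<in>{1..n} - S. \<forall>s\<in>S. ((z, s) \<in> E \<longleftrightarrow> s \<in> X) \<and> ((s, z) \<in> E \<longleftrightarrow> s \<in> Y)))"

text \<open>Bound variables count too: each variable is a pebble, and reusing a variable moves its
  pebble. The size of this set thus bounds the number of vertices in play at any time.\<close>

fun all_vars :: "'r fm \<Rightarrow> nat set" where
  "all_vars (Eq x y) = {x, y}"
| "all_vars (Rel R xs) = set xs"
| "all_vars (Neg \<phi>) = all_vars \<phi>"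
| "all_vars (Conj \<phi> \<psi>) = all_vars \<phi> \<union> all_vars \<psi>"
| "all_vars (Ex x \<phi>) = insert x (all_vars \<phi>)"

lemma finite_all_vars: "finite (all_vars \<phi>)"
  by (induction \<phi>) auto

text \<open>The correspondence \<open>e v \<mapsto> h v\<close> is a partial isomorphism. Phrasing
  it through assignments lets several variables name the same vertex.\<close>

definition partial_iso ::
  "nat set \<Rightarrow> (nat \<times> nat) set \<Rightarrow> (nat \<times> nat) set \<Rightarrow> (nat \<Rightarrow> nat) \<Rightarrow> (nat \<Rightarrow> nat) \<Rightarrow> bool" where
  "partial_iso V E F e h \<longleftrightarrow> (\<forall>u\<in>V. \<forall>v\<in>V.
     (e u = e v \<longleftrightarrow> h u = h v) \<and> ((e u, e v) \<in> E \<longleftrightarrow> (h u, h v) \<in> F))"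

lemma partial_iso_commute: "partial_iso V E F e h \<longleftrightarrow> partial_iso V F E h e"
  by (auto simp: partial_iso_def)

text \<open>This is one round of the pebble game: pebble \<open>x\<close> moves to \<open>a\<close>,
  and the other side answers with \<open>b\<close>. Irreflexivity settles the loop at the new
  vertex, on which the extension property is silent.\<close>

lemma partial_iso_extend:
  assumes iso: "partial_iso V E F e h" and V: "finite V" "card V \<le> k"
    and F: "extension_property k m F" "irrefl F" and E: "irrefl E"
    and h: "h ` V \<subseteq> {1..m}" and x: "x \<in> V"
  obtains b where "b \<in> {1..m}" "partial_iso V E F (e(x := a)) (h(x := b))"
\<comment> \<open>If another pebble already lies on \<open>a\<close>, the answer is the partner of
  that pebble; otherwise a fresh vertex is needed.\<close>
proof (cases "a \<in> e ` (V - {x})")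
  case True
  then obtain u where u: "u \<in> V" "u \<noteq> x" "a = e u" by auto
  then have "partial_iso V E F (e(x := a)) (h(x := h u))"
    using iso by (auto simp: partial_iso_def)
  with u h that show ?thesis by blast
next
  case False
  let ?W = "V - {x}"
  let ?S = "h ` ?W"
  have S: "?S \<subseteq> {1..m}" "card ?S \<le> k"
    using h V card_image_le[of ?W h] card_mono[of V ?W] by auto
  \<comment> \<open>The adjacency pattern of \<open>a\<close> towards the remaining pebbles, copied
    to the other side along \<open>h\<close>.\<close>
  let ?X = "h ` {w \<in> ?W. (a, e w) \<in> E}" and ?Y = "h ` {w \<in> ?W. (e w, a) \<in> E}"
  have "?S \<subseteq> {1..m} \<and> card ?S \<le> k \<and> ?X \<subseteq> ?S \<and> ?Y \<subseteq> ?S"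
    using S by auto
  from F(1)[unfolded extension_property_def, rule_format, OF this]
  obtain z where z: "z \<in> {1..m} - ?S"
    "\<forall>s\<in>?S. ((z, s) \<in> F \<longleftrightarrow> s \<in> ?X) \<and> ((s, z) \<in> F \<longleftrightarrow> s \<in> ?Y)"
    by (elim bexE)
  have eq: "e v = e w \<longleftrightarrow> h v = h w" if "v \<in> ?W" "w \<in> ?W" for v w
    using iso that by (auto simp: partial_iso_def)
  have "(z, h v) \<in> F \<longleftrightarrow> (a, e v) \<in> E" "(h v, z) \<in> F \<longleftrightarrow> (e v, a) \<in> E" if "v \<in> ?W" for v
  proof -
    \<comment> \<open>Several variables may have the value \<open>h v\<close>, but by
      \<open>eq\<close> they then share \<open>e v\<close>; hence the copied pattern is
      unambiguous.\<close>
    have "h v \<in> h ` {w \<in> ?W. P (e w)} \<longleftrightarrow> P (e v)" for P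
    proof
      assume "h v \<in> h ` {w \<in> ?W. P (e w)}"
      then obtain w where w: "w \<in> ?W" "P (e w)" "h v = h w" by blast
      then show "P (e v)" using eq[OF that w(1)] by simp
    qed (use that in blast)
    from this[of "\<lambda>y. (a, y) \<in> E"] this[of "\<lambda>y. (y, a) \<in> E"]
    show "(z, h v) \<in> F \<longleftrightarrow> (a, e v) \<in> E" "(h v, z) \<in> F \<longleftrightarrow> (e v, a) \<in> E"
      using z(2)[rule_format, of "h v"] that by (simp_all only: imageI)
  qed
  moreover have "e v \<noteq> a" "h v \<noteq> z" if "v \<in> ?W" for v
    using False z(1) that by auto
  moreover have "(a, a) \<notin> E" "(z, z) \<notin> F"
    using E F(2) by (auto simp: irrefl_def)
  ultimately have "partial_iso V E F (e(x := a)) (h(x := z))"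
    using iso unfolding partial_iso_def by (auto simp: eq_commute)
  with z that show ?thesis by blast
qed

text \<open>Atoms are decided by the partial isomorphism, and each quantifier is one round of the
  game. The set \<open>V\<close> of pebbles stays fixed throughout the induction.\<close>

lemma sat_partial_iso:
  assumes "partial_iso V E F e h" "wf_fm (binary_sig R) \<phi>" "all_vars \<phi> \<subseteq> V"
    "e ` V \<subseteq> {1..n}" "h ` V \<subseteq> {1..m}"
    and V: "finite V" "card V \<le> k"
    and E: "extension_property k n E" "irrefl E"
    and F: "extension_property k m F" "irrefl F"
  shows "sat (binary_struct R n E) e \<phi> \<longleftrightarrow> sat (binary_struct R m F) h \<phi>"
  using assms(1-5)
proof (induction \<phi> arbitrary: e h)
  case (Eq x y)
  then show ?case by (auto simp: partial_iso_def)
next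
  case (Rel S xs)
  then obtain x y where "S = R" "xs = [x, y]"
    by (auto elim: binary_sig_eq_Some_length)
  then show ?case using Rel by (auto simp: partial_iso_def binary_struct_def)
next
  case (Neg \<phi>)
  then show ?case by simp
next
  case (Conj \<phi> \<psi>)
  then show ?case by simp
next
  case (Ex x \<phi>)
  have x: "x \<in> V" using Ex.prems by simp
  have step: "sat (binary_struct R n E) (e(x := a)) \<phi> \<longleftrightarrow> sat (binary_struct R m F) (h(x := b)) \<phi>"
    if "partial_iso V E F (e(x := a)) (h(x := b))" "a \<in> {1..n}" "b \<in> {1..m}" for a b
    using that(2,3) Ex.prems by (intro Ex.IH that(1)) auto
  have dom: "universe (binary_struct R n G) = {1..n}" for n G
    by (simp add: binary_struct_def)
  show ?case
  proof
    assume "sat (binary_struct R n E) e (Ex x \<phi>)"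
    then obtain a where a: "a \<in> {1..n}" "sat (binary_struct R n E) (e(x := a)) \<phi>"
      unfolding sat.simps dom by blast
    obtain b where "b \<in> {1..m}" "partial_iso V E F (e(x := a)) (h(x := b))"
      using partial_iso_extend[OF Ex.prems(1) V F E(2) Ex.prems(5) x] .
    then show "sat (binary_struct R m F) h (Ex x \<phi>)"
      using step a unfolding sat.simps dom by blast
  next
    assume "sat (binary_struct R m F) h (Ex x \<phi>)"
    then obtain b where b: "b \<in> {1..m}" "sat (binary_struct R m F) (h(x := b)) \<phi>"
      unfolding sat.simps dom by blast
    \<comment> \<open>The reverse round is the same lemma with the two sides exchanged.\<close>
    obtain a where "a \<in> {1..n}" "partial_iso V F E (h(x := b)) (e(x := a))"
      using partial_iso_extend[OF Ex.prems(1)[unfolded partial_iso_commute[of V E]] V E F(2) Ex.prems(4) x] .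
    then show "sat (binary_struct R n E) e (Ex x \<phi>)"
      using step b unfolding sat.simps dom partial_iso_commute[of V F] by blast
  qed
qed

section \<open>Evaluating sentences under a single assignment\<close>

lemma sat_cong_free_vars: "(\<And>x. x \<in> free_vars \<phi> \<Longrightarrow> e x = h x) \<Longrightarrow> sat M e \<phi> \<longleftrightarrow> sat M h \<phi>"
proof (induction \<phi> arbitrary: e h)
  case (Rel R xs)
  then have "map e xs = map h xs" by simp
  then show ?case by (simp del: map_eq_conv)
next
  case (Neg \<phi>)
  then show ?case by (metis free_vars.simps(3) sat.simps(3))
next
  case (Conj \<phi> \<psi>)
  then show ?case by (metis UnCI free_vars.simps(4) sat.simps(4))
next
  case (Ex x \<phi>)
  have "sat M (e(x := a)) \<phi> \<longleftrightarrow> sat M (h(x := a)) \<phi>" for a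
    using Ex.prems by (intro Ex.IH) auto
  then show ?case by simp
qed simp

text \<open>Truth in a structure quantifies over all assignments into the universe; for a sentence
  they all agree, and the given \<open>e\<close> keeps that quantifier from being vacuous.\<close>

lemma models_iff_sat:
  assumes "free_vars \<phi> = {}" "range e \<subseteq> universe M"
  shows "M \<Turnstile> \<phi> \<longleftrightarrow> sat M e \<phi>"
proof -
  have "sat M e' \<phi> \<longleftrightarrow> sat M e \<phi>" for e'
    by (rule sat_cong_free_vars) (simp add: assms(1))
  then show ?thesis
    using assms(2) by (auto simp: models_def)
qed

lemma models_extension_property:
  assumes \<phi>: "sentence (binary_sig R) \<phi>"
    and "extension_property (card (all_vars \<phi>)) n E" "irrefl E" "n \<ge> 1"
    and "extension_property (card (all_vars \<phi>)) m F" "irrefl F" "m \<ge> 1"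
  shows "binary_struct R n E \<Turnstile> \<phi> \<longleftrightarrow> binary_struct R m F \<Turnstile> \<phi>"
proof -
  \<comment> \<open>All pebbles start on vertex 1 in both structures. This is a partial isomorphism
    because neither side has a loop there.\<close>
  let ?e = "\<lambda>_::nat. 1::nat"
  have "sat (binary_struct R n E) ?e \<phi> \<longleftrightarrow> sat (binary_struct R m F) ?e \<phi>"
    using assms by (intro sat_partial_iso[where V = "all_vars \<phi>" and k = "card (all_vars \<phi>)"])
      (auto simp: partial_iso_def finite_all_vars sentence_def irrefl_def)
  moreover have "binary_struct R n G \<Turnstile> \<phi> \<longleftrightarrow> sat (binary_struct R n G) ?e \<phi>" if "n \<ge> 1" for n G
    using \<phi> that by (intro models_iff_sat) (auto simp: sentence_def binary_struct_def)
  ultimately show ?thesis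
    using assms by simp
qed

section \<open>The zero-one law\<close>

text \<open>Each candidate \<open>z\<close> depends only on its own arcs to and from
  \<open>S\<close>, so the candidates fail independently. A prescribed pattern on these
  \<open>2 * card S\<close> arcs has probability at least \<open>min p (1 - p)\<close> per
  arc.\<close>

lemma prob_no_extension_le:
  assumes "finite A" "finite T" "finite S" "T \<inter> S = {}" "T \<times> S \<union> S \<times> T \<subseteq> A" "0 < p" "p < 1"
  shows "measure_pmf.prob (random_subset A p)
           {E. \<forall>z\<in>T. \<not> (\<forall>s\<in>S. ((z, s) \<in> E \<longleftrightarrow> s \<in> X) \<and> ((s, z) \<in> E \<longleftrightarrow> s \<in> Y))}
         \<le> (1 - (min p (1 - p)) ^ (2 * card S)) ^ card T"
proof -
  define K where "K z = {z} \<times> S \<union> S \<times> {z}" for z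
  define g where "g z b \<longleftrightarrow> (\<forall>s\<in>S. (b (z, s) \<longleftrightarrow> s \<in> X) \<and> (b (s, z) \<longleftrightarrow> s \<in> Y))" for z b
  let ?q = "min p (1 - p)"
  let ?P = "\<lambda>A. Pi_pmf A False (\<lambda>_. bernoulli_pmf p)"
  have "measure_pmf.prob (random_subset A p)
           {E. \<forall>z\<in>T. \<not> (\<forall>s\<in>S. ((z, s) \<in> E \<longleftrightarrow> s \<in> X) \<and> ((s, z) \<in> E \<longleftrightarrow> s \<in> Y))}
      = measure_pmf.prob (?P A) {b. \<forall>z\<in>T. \<not> g z b}"
  proof -
    have "(z, s) \<in> A \<and> (s, z) \<in> A" if "z \<in> T" "s \<in> S" for z s
      using assms(5) that by auto
    then show ?thesis
      unfolding random_subset_def measure_map_pmf g_def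
      by (intro arg_cong[where f = "measure_pmf.prob _"]) (auto simp: vimage_def)
  qed
  \<comment> \<open>The event becomes a product event, all indicators being \<open>False\<close>, in
    the joint law of the indicators of success.\<close>
  also have "\<dots> = measure_pmf.prob (map_pmf (\<lambda>b z. if z \<in> T then g z b else False) (?P A))
                    (Pi T (\<lambda>_. {False}))"
    unfolding measure_map_pmf
    by (intro arg_cong[where f = "measure_pmf.prob _"]) (auto simp: vimage_def)
  also have "map_pmf (\<lambda>b z. if z \<in> T then g z b else False) (?P A) =
             Pi_pmf T False (\<lambda>z. map_pmf (g z) (?P (K z)))"
  proof (rule Pi_pmf_blocks)
    show "g z b = g z b'" if "\<And>x. x \<in> K z \<Longrightarrow> b x = b' x" for z b b'
      using that by (auto simp: g_def K_def)
  qed (use assms in \<open>auto simp: K_def disjoint_family_on_def\<close>)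
  also have "measure_pmf.prob \<dots> (Pi T (\<lambda>_. {False})) = (\<Prod>z\<in>T. pmf (map_pmf (g z) (?P (K z))) False)"
    using assms by (simp add: measure_Pi_pmf_Pi measure_pmf_single)
  also have "\<dots> \<le> (\<Prod>z\<in>T. 1 - ?q ^ (2 * card S))"
  proof (intro prod_mono conjI)
    fix z assume "z \<in> T"
    then have z: "z \<notin> S" using assms(4) by auto
    \<comment> \<open>The value prescribed for the arc \<open>x\<close>. Since
      \<open>z \<notin> S\<close>, the first component tells outgoing from incoming arcs, and the
      two halves of \<open>K z\<close> are disjoint.\<close>
    define c where "c x = (if fst x = z then snd x \<in> X else fst x \<in> Y)" for x :: "'a \<times> 'a"
    have c: "?q \<le> pmf (bernoulli_pmf p) (c x)" for x
      using assms by (cases "c x") auto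
    have fin: "finite (K z)" using assms by (simp add: K_def)
    have card: "card (K z) = 2 * card S"
      unfolding K_def using z assms(3) by (subst card_Un_disjoint) (auto simp: card_cartesian_product)
    have "?q ^ (2 * card S) = (\<Prod>x\<in>K z. ?q)"
      by (simp add: card)
    also have "\<dots> \<le> (\<Prod>x\<in>K z. measure_pmf.prob (bernoulli_pmf p) {c x})"
      by (intro prod_mono) (use assms c in \<open>auto simp: measure_pmf_single\<close>)
    also have "\<dots> = measure_pmf.prob (?P (K z)) (Pi (K z) (\<lambda>x. {c x}))"
      using fin by (simp add: measure_Pi_pmf_Pi)
    also have "Pi (K z) (\<lambda>x. {c x}) = {b. g z b}"
      using z by (auto simp: K_def g_def c_def Pi_def)
    also have "measure_pmf.prob (?P (K z)) {b. g z b} = 1 - pmf (map_pmf (g z) (?P (K z))) False"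
      by (subst pmf_map, subst measure_pmf.prob_compl[symmetric])
        (auto intro!: arg_cong[where f = "measure_pmf.prob _"])
    finally show "pmf (map_pmf (g z) (?P (K z))) False \<le> 1 - ?q ^ (2 * card S)"
      by simp
  qed simp
  finally show ?thesis
    by simp
qed

lemma card_small_subsets_le: "card {S. S \<subseteq> {1..n::nat} \<and> card S \<le> k} \<le> (n + 1) ^ k"
proof -
  let ?L = "{xs. set xs \<subseteq> {0..n} \<and> length xs = k}"
  have "{S. S \<subseteq> {1..n} \<and> card S \<le> k} \<subseteq> (\<lambda>xs. set xs - {0}) ` ?L"
  proof safe
    fix S :: "nat set" assume S: "S \<subseteq> {1..n}" "card S \<le> k"
    then have "finite S" by (auto intro: finite_subset)
    then obtain xs where xs: "set xs = S" "length xs = card S"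
      by (metis finite_distinct_list distinct_card)
    \<comment> \<open>Enumerate \<open>S\<close> and pad with \<open>0\<close>, which is not a vertex.\<close>
    show "S \<in> (\<lambda>xs. set xs - {0}) ` ?L"
      by (rule image_eqI[where x = "xs @ replicate (k - card S) 0"]) (use S xs in auto)
  qed
  then have "card {S. S \<subseteq> {1..n} \<and> card S \<le> k} \<le> card ?L"
    by (rule surj_card_le[OF finite_lists_length_eq[OF finite_atLeastAtMost]])
  then show ?thesis
    by (simp add: card_lists_length_eq)
qed

text \<open>Union bound over the triples \<open>(S, X, Y)\<close>. Each component is a set of at
  most \<open>k\<close> vertices, so there are only polynomially many triples against an
  exponentially small failure probability.\<close>

lemma prob_not_extension_property_le:
  assumes p: "0 < p" "p < 1"
  shows "measure_pmf.prob (random_subset (arcs n) p) {E. \<not> extension_property k n E}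
         \<le> (real n + 1) ^ (3 * k) * (1 - (min p (1 - p)) ^ (2 * k)) ^ (n - k)"
proof -
  let ?D = "random_subset (arcs n) p" and ?q = "min p (1 - p)"
  let ?C = "{S. S \<subseteq> {1..n} \<and> card S \<le> k}"
  let ?N = "\<lambda>(S, X, Y). {E. \<forall>z\<in>{1..n} - S. \<not> (\<forall>s\<in>S. ((z, s) \<in> E \<longleftrightarrow> s \<in> X) \<and> ((s, z) \<in> E \<longleftrightarrow> s \<in> Y))}"
  let ?r = "(1 - ?q ^ (2 * k)) ^ (n - k)"
  have fin: "finite ?C" by simp
  have q: "0 < ?q" "?q < 1" using p by auto
  have bound: "measure_pmf.prob ?D (?N (S, X, Y)) \<le> ?r" if "S \<in> ?C" for S X Y
  proof -
    have "finite S" using that by (auto intro: finite_subset)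
    have "measure_pmf.prob ?D (?N (S, X, Y)) \<le> (1 - ?q ^ (2 * card S)) ^ card ({1..n} - S)"
      unfolding prod.case
      by (rule prob_no_extension_le) (use that p finite_arcs \<open>finite S\<close> in auto)
    \<comment> \<open>A smaller \<open>S\<close> only helps: its patterns are more likely, and, in
      the next step, more candidates lie outside it.\<close>
    also have "\<dots> \<le> (1 - ?q ^ (2 * k)) ^ card ({1..n} - S)"
      using that q by (intro power_mono) (auto intro!: power_decreasing power_le_one)
    also have "\<dots> \<le> ?r"
    proof (rule power_decreasing)
      show "n - k \<le> card ({1..n} - S)"
        using that \<open>finite S\<close> by (auto simp: card_Diff_subset diff_le_mono2)
    qed (use q in \<open>auto intro: power_le_one\<close>)
    finally show ?thesis .
  qed
  \<comment> \<open>Letting \<open>X\<close> and \<open>Y\<close> range over all of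
    \<open>?C\<close>, not just the subsets of \<open>S\<close>, makes the index set a plain
    product; \<open>bound\<close> holds for any \<open>X\<close> and \<open>Y\<close>.\<close>
  have "{E. \<not> extension_property k n E} \<subseteq> (\<Union>t\<in>?C \<times> ?C \<times> ?C. ?N t)"
  proof
    fix E assume "E \<in> {E. \<not> extension_property k n E}"
    then obtain S X Y where SXY: "S \<subseteq> {1..n}" "card S \<le> k" "X \<subseteq> S" "Y \<subseteq> S" "E \<in> ?N (S, X, Y)"
      unfolding extension_property_def by auto
    moreover have "finite S" using SXY(1) by (rule finite_subset) simp
    ultimately have "(S, X, Y) \<in> ?C \<times> ?C \<times> ?C"
      using card_mono[of S X] card_mono[of S Y] by auto
    then show "E \<in> (\<Union>t\<in>?C \<times> ?C \<times> ?C. ?N t)"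
      using SXY(5) by blast
  qed
  then have "measure_pmf.prob ?D {E. \<not> extension_property k n E} \<le>
      measure_pmf.prob ?D (\<Union>t\<in>?C \<times> ?C \<times> ?C. ?N t)"
    by (intro measure_pmf.finite_measure_mono) auto
  also have "\<dots> \<le> (\<Sum>t\<in>?C \<times> ?C \<times> ?C. measure_pmf.prob ?D (?N t))"
    by (intro measure_pmf.finite_measure_subadditive_finite) (use fin in auto)
  also have "\<dots> \<le> of_nat (card (?C \<times> ?C \<times> ?C)) * ?r"
    by (intro sum_bounded_above) (use bound in auto)
  also have "\<dots> \<le> (real n + 1) ^ (3 * k) * ?r"
  proof (rule mult_right_mono)
    have "card (?C \<times> ?C \<times> ?C) = card ?C ^ 3"
      by (simp add: card_cartesian_product power3_eq_cube)
    also have "\<dots> \<le> ((n + 1) ^ k) ^ 3"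
      by (intro power_mono card_small_subsets_le) simp
    finally have "real (card (?C \<times> ?C \<times> ?C)) \<le> real ((n + 1) ^ (3 * k))"
      unfolding of_nat_le_iff by (simp add: power_mult[symmetric] mult.commute)
    then show "real (card (?C \<times> ?C \<times> ?C)) \<le> (real n + 1) ^ (3 * k)"
      by (simp add: add.commute)
  qed (use q in \<open>auto intro!: zero_le_power power_le_one\<close>)
  finally show ?thesis .
qed

lemma power_times_geometric_tendsto_0:
  fixes r :: real
  assumes "0 \<le> r" "r < 1"
  shows "(\<lambda>n. (real n + 1) ^ m * r ^ (n - k)) \<longlonglongrightarrow> 0"
proof (cases "r = 0")
  case True
  \<comment> \<open>For \<open>n \<le> k\<close> the truncated exponent is 0 and the power equals 1,
    so vanishing starts at \<open>Suc k\<close>. The case \<open>r = 0\<close> arises from the bound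
    above when its \<open>k\<close> is 0.\<close>
  have "eventually (\<lambda>n. (real n + 1) ^ m * r ^ (n - k) = 0) sequentially"
    using True by (intro eventually_sequentiallyI[of "Suc k"]) simp
  then show ?thesis by (rule tendsto_eventually)
next
  case False
  then have r: "0 < r" "r < 1" using assms by auto
  then have "(\<lambda>n::nat. (real n + 1) ^ m * r ^ n / r ^ k) \<longlonglongrightarrow> 0"
    by real_asymp
  moreover have "eventually (\<lambda>n. (real n + 1) ^ m * r ^ n / r ^ k = (real n + 1) ^ m * r ^ (n - k)) sequentially"
    using r by (intro eventually_sequentiallyI[of k]) (simp add: power_diff)
  ultimately show ?thesis
    by (rule Lim_transform_eventually)
qed

lemma prob_extension_property_tendsto_1:
  assumes p: "0 < p" "p < 1"
  shows "(\<lambda>n. measure_pmf.prob (random_subset (arcs n) p) {E. extension_property k n E}) \<longlonglongrightarrow> 1"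
proof -
  let ?q = "min p (1 - p)"
  have q: "0 < ?q ^ (2 * k)" "?q ^ (2 * k) \<le> 1"
    using p by (auto intro!: power_le_one)
  have "(\<lambda>n. measure_pmf.prob (random_subset (arcs n) p) {E. \<not> extension_property k n E}) \<longlonglongrightarrow> 0"
  proof (rule tendsto_sandwich[OF _ _ tendsto_const[of 0]])
    show "(\<lambda>n. (real n + 1) ^ (3 * k) * (1 - ?q ^ (2 * k)) ^ (n - k)) \<longlonglongrightarrow> 0"
      using q by (intro power_times_geometric_tendsto_0) auto
  qed (use prob_not_extension_property_le[OF p] in auto)
  then have "(\<lambda>n. 1 - measure_pmf.prob (random_subset (arcs n) p) {E. \<not> extension_property k n E}) \<longlonglongrightarrow> 1 - 0"
    by (intro tendsto_intros)
  moreover have "1 - measure_pmf.prob (random_subset (arcs n) p) {E. \<not> extension_property k n E} =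
      measure_pmf.prob (random_subset (arcs n) p) {E. extension_property k n E}" for n
    by (subst measure_pmf.prob_compl[symmetric]) (auto intro!: arg_cong[where f = "measure_pmf.prob _"])
  ultimately show ?thesis by simp
qed

lemma FO_zero_one_law_digraph:
  assumes p: "0 < p" "p < 1"
  shows "FO_zero_one_law (binary_sig Arc) (\<lambda>n. rand_digraph n p)"
proof -
  have "(\<lambda>n. prob_models (rand_digraph n p) \<phi>) \<longlonglongrightarrow> 0 \<or>
        (\<lambda>n. prob_models (rand_digraph n p) \<phi>) \<longlonglongrightarrow> 1"
    if \<phi>: "sentence (binary_sig Arc) \<phi>" for \<phi>
  proof -
    let ?k = "card (all_vars \<phi>)"
    let ?D = "\<lambda>n. random_subset (arcs n) p"
    let ?ext = "\<lambda>n. measure_pmf.prob (?D n) {E. extension_property ?k n E}"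
    let ?M = "binary_struct Arc"
    have lim: "?ext \<longlonglongrightarrow> 1"
      using prob_extension_property_tendsto_1[OF p] .
    have prob: "prob_models (rand_digraph n p) \<phi> = measure_pmf.prob (?D n) {E. ?M n E \<Turnstile> \<phi>}" for n
      by (simp add: prob_models_def rand_digraph_def measure_map_pmf vimage_def)
    have irrefl: "irrefl E" if "E \<in> set_pmf (?D n)" for E n
      using that set_pmf_random_subset[of "arcs n" p] by (auto simp: irrefl_def)
    show ?thesis
    \<comment> \<open>All loopless digraphs with the extension property agree on
      \<open>\<phi>\<close>, so a single one satisfying it forces the limit 1. If none does,
      \<open>\<phi>\<close> can hold only where the property fails, and the limit is 0.\<close>
    proof (cases "\<exists>m F. m \<ge> 1 \<and> irrefl F \<and> extension_property ?k m F \<and> ?M m F \<Turnstile> \<phi>")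
      case True
      then obtain m F where F: "m \<ge> 1" "irrefl F" "extension_property ?k m F" "?M m F \<Turnstile> \<phi>"
        by blast
      \<comment> \<open>The inclusion of events holds only almost surely, because irreflexivity is
        guaranteed only on the support of the random arc set.\<close>
      have "?ext n \<le> prob_models (rand_digraph n p) \<phi>" if "n \<ge> 1" for n
        unfolding prob
        using models_extension_property[OF \<phi>, of n _ m F] that F irrefl
        by (intro measure_pmf.finite_measure_mono_AE) (auto intro!: AE_pmfI)
      then have "(\<lambda>n. prob_models (rand_digraph n p) \<phi>) \<longlonglongrightarrow> 1"
        by (intro tendsto_sandwich[OF _ _ lim tendsto_const] eventually_sequentiallyI[of 1])
          (auto simp: prob)
      then show ?thesis ..
    next
      case False
      have le: "prob_models (rand_digraph n p) \<phi> \<le> 1 - ?ext n" if "n \<ge> 1" for n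
      proof -
        have "prob_models (rand_digraph n p) \<phi> \<le> measure_pmf.prob (?D n) (UNIV - {E. extension_property ?k n E})"
          unfolding prob
          using False that irrefl
          by (intro measure_pmf.finite_measure_mono_AE) (auto intro!: AE_pmfI)
        then show ?thesis
          using measure_pmf.prob_compl[of "{E. extension_property ?k n E}" "?D n"] by simp
      qed
      have lim0: "(\<lambda>n. 1 - ?ext n) \<longlonglongrightarrow> 0"
        using tendsto_diff[OF tendsto_const[of 1] lim] by simp
      have "(\<lambda>n. prob_models (rand_digraph n p) \<phi>) \<longlonglongrightarrow> 0"
      proof (rule real_tendsto_sandwich[OF _ _ tendsto_const lim0])
        show "eventually (\<lambda>n. prob_models (rand_digraph n p) \<phi> \<le> 1 - ?ext n) sequentially"
          using le by (rule eventually_sequentiallyI)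
      qed (simp add: prob)
      then show ?thesis ..
    qed
  qed
  then show ?thesis
    unfolding FO_zero_one_law_def by (intro conjI allI impI random_structures_digraph)
qed

theorem theorem4:
  shows "(\<forall>p :: nat \<Rightarrow> real. (\<forall>n\<ge>1. 0 < p n \<and> p n < 1) \<longrightarrow>
            FO_reducible (binary_sig Adj) (\<lambda>n. rand_graph n ((p n)\<^sup>2))
                         (binary_sig Arc) (\<lambda>n. rand_digraph n (p n)) \<and>
            FO_reducible (binary_sig Arc) (\<lambda>n. rand_digraph n (p n))
                         (binary_sig PSym) (\<lambda>n. rand_binary n (p n))) \<and>
         (\<forall>p :: real. 0 < p \<and> p < 1 \<longrightarrow>
            FO_zero_one_law (binary_sig Arc) (\<lambda>n. rand_digraph n p))"
proof (intro conjI allI impI)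
  fix p :: "nat \<Rightarrow> real"
  assume "\<forall>n\<ge>1. 0 < p n \<and> p n < 1"
  then have p: "0 \<le> p n \<and> p n \<le> 1" if "n \<ge> 1" for n
    using that by (auto intro: less_imp_le)
  show "FO_reducible (binary_sig Adj) (\<lambda>n. rand_graph n ((p n)\<^sup>2))
                     (binary_sig Arc) (\<lambda>n. rand_digraph n (p n))"
    using p by (rule FO_reducible_graph_digraph)
  show "FO_reducible (binary_sig Arc) (\<lambda>n. rand_digraph n (p n))
                     (binary_sig PSym) (\<lambda>n. rand_binary n (p n))"
    using p by (rule FO_reducible_digraph_binary)
qed (simp add: FO_zero_one_law_digraph)

end
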